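(* Suppose that there exists $\bar\theta\in(0,\infty]$ such that for all $\theta\in[0,\bar\theta)$ there exists a solution $\hat\alpha(\theta)\in\mathcal{A}$ to the dual problem $\Gamma(\theta)$ (i.e. $\Gamma(\theta)=\Gamma(\theta,\hat\alpha(\theta))$), with the upper limit being a limit: $$\Gamma(\theta)=\lim_{T\to\infty}\frac1T\ln\mathbb{E}\Big[\exp\big(\theta X_T^{\hat\alpha(\theta)}\big)\Big].$$ Suppose also that $\Gamma$ is continuously differentiable on $[0,\bar\theta)$. Then for all $x<\Gamma'(\bar\theta):=\lim_{\theta\nearrow\bar\theta}\Gamma'(\theta)$, $$v(x)=-\sup_{\theta\in[0,\bar\theta)}\big[\theta x-\Gamma(\theta)\big].$$ Moreover, for such $x$, the sequence of controls (for $n$ large enough) $$\alpha^{*,n}_t=\begin{cases}\hat\alpha_t\big(\theta(x+\tfrac1n)\big), & \Gamma'(0)<x<\Gamma'(\bar\theta),\\[2pt] \hat\alpha_t\big(\theta(\Gamma'(0)+\tfrac1n)\big), & x\le\Gamma'(0),\end{cases}$$ where, for $y\in(\Gamma'(0),\Gamma'(\bar\theta))$, $\theta(y)\in(0,\bar\theta)$ is such that $\Gamma'(\theta(y))=y$, is nearly optimal in the sense that $$\lim_{n\to\infty}\limsup_{T\to\infty}\frac1T\ln\mathbb{P}\big[\bar X_T^{\alpha^{*,n}}\ge x\big]=v(x).$$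
   Context: On a filtered probability space $(\Omega,\mathcal{F},(\mathcal{F}_t)_{t\ge0},\mathbb{P})$, let $\mathcal{A}$ be the set of control processes $\alpha=(\alpha_t)_{t\ge0}$, valued in a subset $A$ of $\mathbb{R}^q$. To each $\alpha\in\mathcal{A}$ is associated a controlled process $Z^\alpha=(X^\alpha,Y^\alpha)$ valued in $\mathbb{R}\times\mathbb{R}^d$ (an abstract setting; no specific dynamics are assumed). For $T>0$ put $\bar X_T^\alpha=X_T^\alpha/T$. The large deviations control problem is $$v(x)=\sup_{\alpha\in\mathcal{A}}\limsup_{T\to\infty}\frac1T\ln\mathbb{P}[\bar X_T^\alpha\ge x],\qquad x\in\mathbb{R}.$$ For $\theta\ge0$ and $\alpha\in\mathcal{A}$ define $$\Gamma(\theta,\alpha)=\limsup_{T\to\infty}\frac1T\ln\mathbb{E}\big[e^{\theta X_T^\alpha}\big],$$ and the dual problem is $\Gamma(\theta)=\sup_{\alpha\in\mathcal{A}}\Gamma(\theta,\alpha)$. The derivative $\Gamma'(0)$ at $0$ is the right derivative. For $\theta\in[0,\bar\theta)$, $\hat\alpha_t(\theta)$ denotes the value at time $t$ of the control process $\hat\alpha(\theta)$.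
   Formalization: The near-optimality claim is stated under the condition Γ'(0) < Γ'(θ̄); if Γ'(0) = Γ'(θ̄) (Γ affine, e.g. X_T = cT) no θ(Γ'(0)+1/n) exists, so the controls α^{*,n} are undefined. The formula for v(x) is stated without this condition. *)

theory Defs
  imports "HOL-Probability.Probability"
begin

type_synonym ('w, 'q) control = "real \<Rightarrow> 'w \<Rightarrow> real ^ 'q"
type_synonym ('w, 'd) controlled_process = "real \<Rightarrow> 'w \<Rightarrow> real \<times> (real ^ 'd)"

text \<open>Processes are indexed by the nonnegative reals; their values at negative times play no role.
  The set of controls is an arbitrary set of processes with values in \<open>A\<close>. Adaptedness is not
  required, so any choice of admissible controls (adapted, progressively measurable, ...) is covered.\<close>

locale large_deviations_control = prob_space M
  for M :: "'w measure"
    and F :: "real \<Rightarrow> 'w measure"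
    and A :: "(real ^ 'q::finite) set"
    and Ctrl :: "('w, 'q) control set"
    and Z :: "('w, 'q) control \<Rightarrow> ('w, 'd::finite) controlled_process" +
  assumes filtration_subalgebra: "\<And>t. 0 \<le> t \<Longrightarrow> subalgebra M (F t)"
    and filtration_mono: "\<And>s t. 0 \<le> s \<Longrightarrow> s \<le> t \<Longrightarrow> sets (F s) \<subseteq> sets (F t)"
    and control_measurable: "\<And>\<alpha> t. \<alpha> \<in> Ctrl \<Longrightarrow> 0 \<le> t \<Longrightarrow> \<alpha> t \<in> borel_measurable M"
    and control_values: "\<And>\<alpha> t \<omega>. \<alpha> \<in> Ctrl \<Longrightarrow> 0 \<le> t \<Longrightarrow> \<omega> \<in> space M \<Longrightarrow> \<alpha> t \<omega> \<in> A"
    and state_measurable: "\<And>\<alpha> t. \<alpha> \<in> Ctrl \<Longrightarrow> 0 \<le> t \<Longrightarrow> Z \<alpha> t \<in> borel_measurable M"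

definition X_of ::
    "(('w, 'q::finite) control \<Rightarrow> ('w, 'd::finite) controlled_process) \<Rightarrow> ('w, 'q) control \<Rightarrow> real \<Rightarrow> 'w \<Rightarrow> real" where
  "X_of Z \<alpha> T \<omega> = fst (Z \<alpha> T \<omega>)"

definition Xbar ::
    "(('w, 'q::finite) control \<Rightarrow> ('w, 'd::finite) controlled_process) \<Rightarrow> ('w, 'q) control \<Rightarrow> real \<Rightarrow> 'w \<Rightarrow> real" where
  "Xbar Z \<alpha> T \<omega> = X_of Z \<alpha> T \<omega> / T"

text \<open>The logarithm on \<open>[0, \<infinity>]\<close>, with \<open>ln 0 = -\<infinity>\<close> and \<open>ln \<infinity> = \<infinity>\<close>.
  (The real \<open>ln\<close> has \<open>ln 0 = 0\<close>, which would be wrong for events of probability zero.)\<close>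

definition eln :: "ennreal \<Rightarrow> ereal" where
  "eln p = (if p = 0 then -\<infinity> else if p = \<infinity> then \<infinity> else ereal (ln (enn2real p)))"

definition log_prob ::
    "'w measure \<Rightarrow> (('w, 'q::finite) control \<Rightarrow> ('w, 'd::finite) controlled_process) \<Rightarrow> real \<Rightarrow> ('w, 'q) control \<Rightarrow> real \<Rightarrow> ereal" where
  "log_prob M Z x \<alpha> T =
     ereal (1 / T) * eln (emeasure M {\<omega> \<in> space M. x \<le> Xbar Z \<alpha> T \<omega>})"

text \<open>The expectation is the Lebesgue integral with values in \<open>[0, \<infinity>]\<close>: no exponential
  moment is assumed to be finite.\<close>

definition log_mgf ::
    "'w measure \<Rightarrow> (('w, 'q::finite) control \<Rightarrow> ('w, 'd::finite) controlled_process) \<Rightarrow> real \<Rightarrow> ('w, 'q) control \<Rightarrow> real \<Rightarrow> ereal" where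
  "log_mgf M Z \<theta> \<alpha> T =
     ereal (1 / T) * eln (\<integral>\<^sup>+ \<omega>. ennreal (exp (\<theta> * X_of Z \<alpha> T \<omega>)) \<partial>M)"

definition ld_value ::
    "'w measure \<Rightarrow> ('w, 'q::finite) control set \<Rightarrow> (('w, 'q::finite) control \<Rightarrow> ('w, 'd::finite) controlled_process) \<Rightarrow> real \<Rightarrow> ereal" where
  "ld_value M Ctrl Z x = (SUP \<alpha>\<in>Ctrl. Limsup at_top (\<lambda>T::real. log_prob M Z x \<alpha> T))"

definition Gamma_ctrl ::
    "'w measure \<Rightarrow> (('w, 'q::finite) control \<Rightarrow> ('w, 'd::finite) controlled_process) \<Rightarrow> real \<Rightarrow> ('w, 'q) control \<Rightarrow> ereal" where
  "Gamma_ctrl M Z \<theta> \<alpha> = Limsup at_top (\<lambda>T::real. log_mgf M Z \<theta> \<alpha> T)"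

definition Gamma_dual ::
    "'w measure \<Rightarrow> ('w, 'q::finite) control set \<Rightarrow> (('w, 'q::finite) control \<Rightarrow> ('w, 'd::finite) controlled_process) \<Rightarrow> real \<Rightarrow> ereal" where
  "Gamma_dual M Ctrl Z \<theta> = (SUP \<alpha>\<in>Ctrl. Gamma_ctrl M Z \<theta> \<alpha>)"

definition theta_range :: "ereal \<Rightarrow> real set" where
  "theta_range \<theta>bar = {\<theta>. 0 \<le> \<theta> \<and> ereal \<theta> < \<theta>bar}"

text \<open>\<open>G'\<close> is the derivative of \<open>G\<close> on \<open>I\<close>, taken within \<open>I\<close>: at the left endpoint of
  \<open>[0, \<theta>bar)\<close> this is the right derivative. Differentiability of an extended real valued function
  includes its finiteness on \<open>I\<close>.\<close>

definition C1_on_with :: "(real \<Rightarrow> ereal) \<Rightarrow> (real \<Rightarrow> real) \<Rightarrow> real set \<Rightarrow> bool" where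
  "C1_on_with G G' I \<longleftrightarrow>
     (\<forall>\<theta>\<in>I. \<bar>G \<theta>\<bar> \<noteq> \<infinity>) \<and>
     (\<forall>\<theta>\<in>I. ((\<lambda>s. real_of_ereal (G s)) has_real_derivative G' \<theta>) (at \<theta> within I)) \<and>
     continuous_on I G'"

text \<open>The limit of \<open>G' \<theta>\<close> as \<open>\<theta>\<close> increases to \<open>\<theta>bar\<close>, in the extended reals; \<open>\<theta>bar\<close> may be \<open>\<infinity>\<close>,
  and so may the limit.\<close>

definition left_end_limit :: "(real \<Rightarrow> real) \<Rightarrow> ereal \<Rightarrow> ereal" where
  "left_end_limit G' \<theta>bar = Lim (at_left \<theta>bar) (\<lambda>\<theta>. ereal (G' (real_of_ereal \<theta>)))"

text \<open>Here \<open>\<theta>sel y\<close> stands for a solution of \<open>G' \<theta> = y\<close>, which exists only for \<open>y\<close> strictly between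
  \<open>G' 0\<close> and the left limit of \<open>G'\<close> at \<open>\<theta>bar\<close>. The control is therefore meaningful only for large \<open>n\<close>,
  and in the second case only if \<open>G' 0\<close> is below that limit.\<close>

definition near_opt_control ::
    "(real \<Rightarrow> ('w, 'q) control) \<Rightarrow> (real \<Rightarrow> real) \<Rightarrow> (real \<Rightarrow> real) \<Rightarrow> real \<Rightarrow> nat \<Rightarrow> ('w, 'q) control" where
  "near_opt_control \<alpha>hat \<theta>sel G' x n =
     (if G' 0 < x then \<alpha>hat (\<theta>sel (x + 1 / real n)) else \<alpha>hat (\<theta>sel (G' 0 + 1 / real n)))"

end

theory Submission
  imports Defs
begin

text \<open>
  Write \<open>g\<close> for the dual value function. The upper bound is Chernoff's inequality: for every control \<open>\<alpha>\<close>
  and every \<open>\<theta> \<ge> 0\<close>, \<open>P (X\<^sub>T \<ge> x T) \<le> exp (- \<theta> x T) * E (exp (\<theta> X\<^sub>T))\<close>, and the expectation grows at a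
  rate of at most \<open>g \<theta>\<close> (\<open>prob_rate_le\<close>).

  The lower bound (\<open>prob_rate_ge\<close>) is the tilting argument of Gaertner and Ellis, carried out at a single
  exponent \<open>\<theta> > 0\<close> under the control that is optimal there. For this control the growth rate of
  \<open>E (exp (\<theta> X\<^sub>T))\<close> is exactly \<open>g \<theta>\<close>, while at nearby exponents it is at most \<open>g\<close>. As \<open>g\<close> is
  differentiable at \<open>\<theta>\<close>, the contributions to this expectation of \<open>X\<^sub>T / T\<close> above or below \<open>G' \<theta>\<close> by a
  margin are exponentially negligible. Hence \<open>X\<^sub>T / T\<close> is near \<open>G' \<theta>\<close>, and in particular above any
  \<open>x < G' \<theta>\<close>, with a probability of rate at least \<open>g \<theta> - \<theta> * G' \<theta>\<close>. At the nearby exponents only upper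
  bounds enter, and these hold for every control; so the argument works although the optimal
  control changes with \<open>\<theta>\<close>.

  The two bounds are matched through convexity. Each \<open>log_mgf\<close> is convex in \<open>\<theta>\<close>, and since the optimum is
  attained as a limit, so is \<open>g\<close> (\<open>convex_g\<close>). So \<open>G'\<close> is monotone, the left end limit is its supremum, and
  by the intermediate value theorem every slope strictly between \<open>G' 0\<close> and that limit is attained.
  Slopes \<open>y + 1 / n\<close> with \<open>y = max x (G' 0)\<close> then yield lower bounds that converge to the upper one
  (\<open>near_opt_control_rate\<close>). If \<open>G'\<close> is constant no such slope exists, but then the conjugate
  vanishes for \<open>x < G' 0\<close> and one fixed exponent suffices (\<open>ld_value_eq\<close>).
\<close>

section \<open>Exponential scale\<close>

lemma scaled_eln_le_iff:
  assumes "T > 0"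
  shows "ereal (1 / T) * eln p \<le> ereal a \<longleftrightarrow> p \<le> ennreal (exp (a * T))"
proof (cases p)
  case (real r)
  show ?thesis
  proof (cases "r = 0")
    case True
    then show ?thesis using real assms by (simp add: eln_def)
  next
    case False
    with real have "r > 0" by simp
    then have "ln r \<le> a * T \<longleftrightarrow> r \<le> exp (a * T)"
      by (metis exp_le_cancel_iff exp_ln)
    then show ?thesis using real \<open>r > 0\<close> assms
      by (simp add: eln_def field_simps)
  qed
next
  case top
  then show ?thesis using assms by (simp add: eln_def top_unique)
qed

lemma le_scaled_eln_iff:
  assumes "T > 0"
  shows "ereal a \<le> ereal (1 / T) * eln p \<longleftrightarrow> ennreal (exp (a * T)) \<le> p"
proof (cases p)
  case (real r)
  show ?thesis
  proof (cases "r = 0")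
    case True
    then show ?thesis using real assms by (simp add: eln_def)
  next
    case False
    with real have "r > 0" by simp
    then have "a * T \<le> ln r \<longleftrightarrow> exp (a * T) \<le> r"
      by (metis exp_le_cancel_iff exp_ln)
    then show ?thesis using real \<open>r > 0\<close> assms
      by (simp add: eln_def field_simps)
  qed
next
  case top
  then show ?thesis using assms by (simp add: eln_def)
qed

section \<open>Exponential moments of one random variable\<close>

context prob_space
begin

lemma Chernoff_bound:
  assumes [measurable]: "X \<in> borel_measurable M" and "\<theta> \<ge> 0"
    and bound: "(\<integral>\<^sup>+ \<omega>. ennreal (exp (\<theta> * X \<omega>)) \<partial>M) \<le> ennreal (exp a)"
  shows "emeasure M {\<omega> \<in> space M. b \<le> X \<omega>} \<le> ennreal (exp (a - \<theta> * b))"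
proof -
  have "emeasure M {\<omega> \<in> space M. b \<le> X \<omega>} = (\<integral>\<^sup>+ \<omega>. indicator {\<omega> \<in> space M. b \<le> X \<omega>} \<omega> \<partial>M)"
    by simp
  also have "\<dots> \<le> (\<integral>\<^sup>+ \<omega>. ennreal (exp (- \<theta> * b)) * ennreal (exp (\<theta> * X \<omega>)) \<partial>M)"
    using \<open>\<theta> \<ge> 0\<close>
    by (intro nn_integral_mono)
       (auto simp: indicator_def ennreal_mult'[symmetric] exp_add[symmetric] mult_left_mono)
  also have "\<dots> = ennreal (exp (- \<theta> * b)) * (\<integral>\<^sup>+ \<omega>. ennreal (exp (\<theta> * X \<omega>)) \<partial>M)"
    by (rule nn_integral_cmult) simp
  also have "\<dots> \<le> ennreal (exp (- \<theta> * b)) * ennreal (exp a)"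
    by (intro mult_left_mono bound) simp
  also have "\<dots> = ennreal (exp (a - \<theta> * b))"
    by (simp add: ennreal_mult'[symmetric] exp_add[symmetric])
  finally show ?thesis .
qed

text \<open>Log-convexity of exponential moments. After normalising both moments by their bounds, it is the
  convexity of \<open>exp\<close> applied under the integral; no integrability is needed, so infinite moments
  at other exponents do no harm.\<close>

lemma exp_moment_convex:
  assumes [measurable]: "X \<in> borel_measurable M" and u: "0 \<le> u" "u \<le> 1"
    and b1: "(\<integral>\<^sup>+ \<omega>. ennreal (exp (\<theta>\<^sub>1 * X \<omega>)) \<partial>M) \<le> ennreal (exp a\<^sub>1)"
    and b2: "(\<integral>\<^sup>+ \<omega>. ennreal (exp (\<theta>\<^sub>2 * X \<omega>)) \<partial>M) \<le> ennreal (exp a\<^sub>2)"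
  shows "(\<integral>\<^sup>+ \<omega>. ennreal (exp (((1 - u) * \<theta>\<^sub>1 + u * \<theta>\<^sub>2) * X \<omega>)) \<partial>M)
           \<le> ennreal (exp ((1 - u) * a\<^sub>1 + u * a\<^sub>2))"
proof -
  let ?E = "exp ((1 - u) * a\<^sub>1 + u * a\<^sub>2)"
  have pt: "exp (((1 - u) * \<theta>\<^sub>1 + u * \<theta>\<^sub>2) * y)
      \<le> ?E * ((1 - u) * exp (- a\<^sub>1)) * exp (\<theta>\<^sub>1 * y) + ?E * (u * exp (- a\<^sub>2)) * exp (\<theta>\<^sub>2 * y)" for y
  proof -
    have "exp ((1 - u) *\<^sub>R (\<theta>\<^sub>1 * y - a\<^sub>1) + u *\<^sub>R (\<theta>\<^sub>2 * y - a\<^sub>2))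
        \<le> (1 - u) * exp (\<theta>\<^sub>1 * y - a\<^sub>1) + u * exp (\<theta>\<^sub>2 * y - a\<^sub>2)"
      using u by (intro convex_onD[OF exp_convex]) auto
    then have "?E * exp ((1 - u) * (\<theta>\<^sub>1 * y - a\<^sub>1) + u * (\<theta>\<^sub>2 * y - a\<^sub>2))
        \<le> ?E * ((1 - u) * exp (\<theta>\<^sub>1 * y - a\<^sub>1) + u * exp (\<theta>\<^sub>2 * y - a\<^sub>2))"
      by (intro mult_left_mono) auto
    moreover have "?E * exp ((1 - u) * (\<theta>\<^sub>1 * y - a\<^sub>1) + u * (\<theta>\<^sub>2 * y - a\<^sub>2))
        = exp (((1 - u) * \<theta>\<^sub>1 + u * \<theta>\<^sub>2) * y)"
      unfolding exp_add[symmetric] by (rule arg_cong[of _ _ exp]) (simp add: algebra_simps)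
    moreover have "exp (\<theta>\<^sub>1 * y - a\<^sub>1) = exp (- a\<^sub>1) * exp (\<theta>\<^sub>1 * y)"
      "exp (\<theta>\<^sub>2 * y - a\<^sub>2) = exp (- a\<^sub>2) * exp (\<theta>\<^sub>2 * y)"
      by (simp_all add: exp_add[symmetric])
    ultimately show ?thesis by (simp add: algebra_simps)
  qed
  have "(\<integral>\<^sup>+ \<omega>. ennreal (exp (((1 - u) * \<theta>\<^sub>1 + u * \<theta>\<^sub>2) * X \<omega>)) \<partial>M)
    \<le> (\<integral>\<^sup>+ \<omega>. ennreal (?E * ((1 - u) * exp (- a\<^sub>1))) * ennreal (exp (\<theta>\<^sub>1 * X \<omega>))
         + ennreal (?E * (u * exp (- a\<^sub>2))) * ennreal (exp (\<theta>\<^sub>2 * X \<omega>)) \<partial>M)"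
    using u pt by (intro nn_integral_mono)
      (simp add: ennreal_mult'[symmetric] ennreal_plus[symmetric] del: ennreal_plus)
  also have "\<dots> = ennreal (?E * ((1 - u) * exp (- a\<^sub>1))) * (\<integral>\<^sup>+ \<omega>. ennreal (exp (\<theta>\<^sub>1 * X \<omega>)) \<partial>M)
         + ennreal (?E * (u * exp (- a\<^sub>2))) * (\<integral>\<^sup>+ \<omega>. ennreal (exp (\<theta>\<^sub>2 * X \<omega>)) \<partial>M)"
    by (simp add: nn_integral_add nn_integral_cmult)
  also have "\<dots> \<le> ennreal (?E * ((1 - u) * exp (- a\<^sub>1))) * ennreal (exp a\<^sub>1)
         + ennreal (?E * (u * exp (- a\<^sub>2))) * ennreal (exp a\<^sub>2)"
    by (intro add_mono mult_left_mono b1 b2) auto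
  also have "\<dots> = ennreal ?E"
    using u by (simp add: ennreal_mult'[symmetric] ennreal_plus[symmetric] exp_minus field_simps del: ennreal_plus)
  finally show ?thesis .
qed

text \<open>This does the work of a change of measure with density proportional to \<open>exp (\<theta> * X)\<close>. On
  \<open>X \<ge> hi\<close> the integrand is at most \<open>exp ((\<theta> + s) * X - s * hi)\<close>, on \<open>X < lo\<close> it is at most
  \<open>exp ((\<theta> - r) * X + r * lo)\<close>, and in between it is at most \<open>exp (\<theta> * hi)\<close>. So if the
  two neighbouring moments are small, most of the \<open>\<theta>\<close>-moment sits on the window, and the window must
  have substantial probability.\<close>

lemma exp_moment_window:
  assumes [measurable]: "X \<in> borel_measurable M" and pos: "0 \<le> \<theta>" "0 \<le> s" "0 \<le> r"
  shows "(\<integral>\<^sup>+ \<omega>. ennreal (exp (\<theta> * X \<omega>)) \<partial>M)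
    \<le> ennreal (exp (- s * hi)) * (\<integral>\<^sup>+ \<omega>. ennreal (exp ((\<theta> + s) * X \<omega>)) \<partial>M)
    + ennreal (exp (r * lo)) * (\<integral>\<^sup>+ \<omega>. ennreal (exp ((\<theta> - r) * X \<omega>)) \<partial>M)
    + ennreal (exp (\<theta> * hi)) * emeasure M {\<omega> \<in> space M. lo \<le> X \<omega>}"
proof -
  let ?S = "{\<omega> \<in> space M. lo \<le> X \<omega>}"
  have pt: "exp (\<theta> * y) \<le> exp (- s * hi) * exp ((\<theta> + s) * y) + exp (r * lo) * exp ((\<theta> - r) * y)
      + exp (\<theta> * hi) * (if lo \<le> y then 1 else 0)" for y
  proof -
    consider "hi \<le> y" | "y < lo" | "lo \<le> y" "y \<le> hi" by linarith
    then show ?thesis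
    proof cases
      case 1
      then have "exp (\<theta> * y) \<le> exp (- s * hi + (\<theta> + s) * y)"
        using mult_left_mono[OF 1 pos(2)] by (simp add: algebra_simps)
      then show ?thesis unfolding exp_add by (auto intro!: add_increasing2 add_nonneg_nonneg)
    next
      case 2
      then have "exp (\<theta> * y) \<le> exp (r * lo + (\<theta> - r) * y)"
        using mult_left_mono[OF less_imp_le[OF 2] pos(3)] by (simp add: algebra_simps)
      then show ?thesis using 2 unfolding exp_add by (auto intro!: add_increasing)
    next
      case 3
      then have "exp (\<theta> * y) \<le> exp (\<theta> * hi)"
        using pos by (simp add: mult_left_mono)
      then show ?thesis using 3 by (auto intro: add_increasing)
    qed
  qed
  have "(\<integral>\<^sup>+ \<omega>. ennreal (exp (\<theta> * X \<omega>)) \<partial>M)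
    \<le> (\<integral>\<^sup>+ \<omega>. ennreal (exp (- s * hi)) * ennreal (exp ((\<theta> + s) * X \<omega>))
         + ennreal (exp (r * lo)) * ennreal (exp ((\<theta> - r) * X \<omega>))
         + ennreal (exp (\<theta> * hi)) * indicator ?S \<omega> \<partial>M)"
  proof (intro nn_integral_mono)
    fix \<omega> assume "\<omega> \<in> space M"
    then have ind: "indicator ?S \<omega> = ennreal (if lo \<le> X \<omega> then 1 else 0)"
      by (simp add: indicator_def)
    show "ennreal (exp (\<theta> * X \<omega>)) \<le> ennreal (exp (- s * hi)) * ennreal (exp ((\<theta> + s) * X \<omega>))
         + ennreal (exp (r * lo)) * ennreal (exp ((\<theta> - r) * X \<omega>))
         + ennreal (exp (\<theta> * hi)) * indicator ?S \<omega>"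
      unfolding ind using ennreal_leI[OF pt[of "X \<omega>"]]
      by (cases "lo \<le> X \<omega>") (simp_all add: ennreal_mult')
  qed
  also have "\<dots> = ennreal (exp (- s * hi)) * (\<integral>\<^sup>+ \<omega>. ennreal (exp ((\<theta> + s) * X \<omega>)) \<partial>M)
    + ennreal (exp (r * lo)) * (\<integral>\<^sup>+ \<omega>. ennreal (exp ((\<theta> - r) * X \<omega>)) \<partial>M)
    + ennreal (exp (\<theta> * hi)) * emeasure M ?S"
    by (simp add: nn_integral_add nn_integral_cmult)
  finally show ?thesis .
qed

text \<open>The factor \<open>3\<close> leaves one third of the \<open>\<theta>\<close>-moment for the window after each tail has taken at most
  another third.\<close>

lemma window_probability_bound:
  assumes X: "X \<in> borel_measurable M" and pos: "0 \<le> \<theta>" "0 \<le> s" "0 \<le> r"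
    and mid: "ennreal (3 * exp b) \<le> (\<integral>\<^sup>+ \<omega>. ennreal (exp (\<theta> * X \<omega>)) \<partial>M)"
    and up: "(\<integral>\<^sup>+ \<omega>. ennreal (exp ((\<theta> + s) * X \<omega>)) \<partial>M) \<le> ennreal (exp (b + s * hi))"
    and down: "(\<integral>\<^sup>+ \<omega>. ennreal (exp ((\<theta> - r) * X \<omega>)) \<partial>M) \<le> ennreal (exp (b - r * lo))"
  shows "ennreal (exp (b - \<theta> * hi)) \<le> emeasure M {\<omega> \<in> space M. lo \<le> X \<omega>}"
proof -
  let ?p = "prob {\<omega> \<in> space M. lo \<le> X \<omega>}"
  have "ennreal (3 * exp b) \<le> ennreal (exp (- s * hi)) * ennreal (exp (b + s * hi))
    + ennreal (exp (r * lo)) * ennreal (exp (b - r * lo)) + ennreal (exp (\<theta> * hi)) * ennreal ?p"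
    unfolding emeasure_eq_measure[symmetric]
    by (rule order_trans[OF order_trans[OF mid exp_moment_window[OF X pos]]])
       (rule add_mono[OF add_mono[OF mult_left_mono[OF up] mult_left_mono[OF down]] order_refl], simp_all)
  also have "\<dots> = ennreal (exp b + exp b + exp (\<theta> * hi) * ?p)"
    by (simp add: ennreal_mult'[symmetric] ennreal_plus[symmetric] exp_add[symmetric] del: ennreal_plus)
  finally have "3 * exp b \<le> exp b + exp b + exp (\<theta> * hi) * ?p"
    by (subst (asm) ennreal_le_iff) (auto intro!: add_nonneg_nonneg)
  then have "exp b \<le> exp (\<theta> * hi) * ?p" by simp
  then have "exp (b - \<theta> * hi) \<le> ?p"
    by (simp add: exp_diff field_simps)
  then show ?thesis by (simp add: emeasure_eq_measure ennreal_leI)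
qed

end

section \<open>Convex functions and their derivatives\<close>

text \<open>The point of tangency may be an end point of \<open>S\<close>. This matters at \<open>\<theta> = 0\<close>, where only a right
  derivative exists.\<close>

lemma convex_above_tangent_within:
  fixes f :: "real \<Rightarrow> real"
  assumes cvx: "convex_on S f" and x: "x \<in> S" and y: "y \<in> S"
    and der: "(f has_real_derivative c) (at x within S)"
  shows "c * (y - x) \<le> f y - f x"
proof (cases "y = x")
  case False
  have "c * (y - x) \<le> f y - f x + e" if "e > 0" for e
  proof -
    have "e / \<bar>y - x\<bar> > 0" using False that by simp
    then obtain d where d: "d > 0" "\<And>z. z \<in> S \<Longrightarrow> \<bar>z - x\<bar> < d \<Longrightarrow>
        \<bar>f z - f x - c * (z - x)\<bar> \<le> e / \<bar>y - x\<bar> * \<bar>z - x\<bar>"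
      using der unfolding has_field_derivative_def has_derivative_within_alt by (auto simp: real_norm_def)
    define t where "t = min 1 (d / (2 * \<bar>y - x\<bar>))"
    have t: "0 < t" "t \<le> 1" using False d by (auto simp: t_def)
    have "t * \<bar>y - x\<bar> \<le> d / (2 * \<bar>y - x\<bar>) * \<bar>y - x\<bar>"
      by (intro mult_right_mono) (auto simp: t_def)
    then have td: "t * \<bar>y - x\<bar> < d" using False d(1) by simp
    define z where "z = (1 - t) *\<^sub>R x + t *\<^sub>R y"
    have zx: "z - x = t * (y - x)" by (simp add: z_def algebra_simps)
    have "z \<in> S" unfolding z_def using t convex_on_imp_convex[OF cvx] x y by (intro convexD) auto
    moreover have "\<bar>z - x\<bar> < d" using td t by (simp add: zx abs_mult)
    ultimately have "\<bar>f z - f x - c * (z - x)\<bar> \<le> e / \<bar>y - x\<bar> * \<bar>z - x\<bar>" by (rule d(2))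
    also have "\<dots> = t * e" using False t by (simp add: zx abs_mult)
    finally have "t * (c * (y - x)) - t * e \<le> f z - f x" by (simp add: zx algebra_simps abs_le_iff)
    moreover have "f z \<le> (1 - t) * f x + t * f y"
      unfolding z_def using t x y by (intro convex_onD[OF cvx]) auto
    ultimately have "t * (c * (y - x)) \<le> t * (f y - f x + e)" by (simp add: algebra_simps)
    then show ?thesis using t by simp
  qed
  then show ?thesis by (rule field_le_epsilon)
qed simp

lemma convex_derivative_mono:
  fixes f :: "real \<Rightarrow> real"
  assumes cvx: "convex_on S f" and S: "x \<in> S" "y \<in> S" and "x \<le> y"
    and der: "\<And>z. z \<in> S \<Longrightarrow> (f has_real_derivative f' z) (at z within S)"
  shows "f' x \<le> f' y"
proof (cases "x = y")
  case False
  have "f' x * (y - x) \<le> f y - f x" "f' y * (x - y) \<le> f x - f y"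
    using convex_above_tangent_within[OF cvx] S der by blast+
  then have "f' x * (y - x) \<le> f' y * (y - x)" by (simp add: algebra_simps)
  then show ?thesis using False \<open>x \<le> y\<close> by simp
qed simp

lemma left_end_limit_mono:
  assumes "0 < b" and mono: "\<And>s t. s \<in> theta_range b \<Longrightarrow> t \<in> theta_range b \<Longrightarrow> s \<le> t \<Longrightarrow> f s \<le> f t"
  shows "left_end_limit f b = (SUP t\<in>theta_range b. ereal (f t))"
proof -
  let ?L = "SUP t\<in>theta_range b. ereal (f t)"
  have ev: "\<forall>\<^sub>F e in at_left b. \<exists>t. e = ereal t \<and> s \<le> t \<and> t \<in> theta_range b"
    if "s \<in> theta_range b" for s
  proof -
    have s: "ereal s < b" "0 \<le> s" using that by (auto simp: theta_range_def)
    show ?thesis unfolding eventually_at_left[OF s(1)]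
    proof (intro exI[of _ "ereal s"] conjI allI impI s(1))
      fix e assume "ereal s < e" "e < b"
      then obtain t where "e = ereal t" by (cases e) auto
      then show "\<exists>t. e = ereal t \<and> s \<le> t \<and> t \<in> theta_range b"
        using \<open>ereal s < e\<close> \<open>e < b\<close> s by (auto simp: theta_range_def)
    qed
  qed
  have "0 \<in> theta_range b" using assms(1) by (simp add: theta_range_def zero_ereal_def[symmetric])
  have lim: "((\<lambda>e. ereal (f (real_of_ereal e))) \<longlongrightarrow> ?L) (at_left b)"
  proof (rule order_tendstoI)
    fix a assume "a < ?L"
    then obtain s where s: "s \<in> theta_range b" "a < ereal (f s)" by (auto simp: less_SUP_iff)
    show "\<forall>\<^sub>F e in at_left b. a < ereal (f (real_of_ereal e))"
      using ev[OF s(1)]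
    proof eventually_elim
      case (elim e)
      then obtain t where "e = ereal t" "s \<le> t" "t \<in> theta_range b" by auto
      then show ?case using mono[of s t] s by (auto intro: less_le_trans)
    qed
  next
    fix a assume a: "?L < a"
    show "\<forall>\<^sub>F e in at_left b. ereal (f (real_of_ereal e)) < a"
      using ev[OF \<open>0 \<in> theta_range b\<close>]
    proof eventually_elim
      case (elim e)
      then obtain t where "e = ereal t" "t \<in> theta_range b" by auto
      then have "ereal (f t) \<le> ?L" by (intro SUP_upper)
      then show ?case using a \<open>e = ereal t\<close> by simp
    qed
  qed
  have "at_left b \<noteq> bot"
    using assms(1) dense by (auto simp: trivial_limit_def eventually_at_left[OF assms(1)])
  from tendsto_Lim[OF this lim] show ?thesis by (simp only: left_end_limit_def)
qed

section \<open>The dual problem\<close>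

locale solvable_dual_problem = large_deviations_control M F A Ctrl Z
  for M :: "'w measure"
    and F :: "real \<Rightarrow> 'w measure"
    and A :: "(real ^ 'q::finite) set"
    and Ctrl :: "('w, 'q) control set"
    and Z :: "('w, 'q) control \<Rightarrow> ('w, 'd::finite) controlled_process" +
  fixes \<theta>bar :: ereal
    and \<alpha>hat :: "real \<Rightarrow> ('w, 'q) control"
    and G' :: "real \<Rightarrow> real"
  assumes \<theta>bar_pos: "0 < \<theta>bar"
    and dual_solution: "\<And>\<theta>. \<theta> \<in> theta_range \<theta>bar \<Longrightarrow>
          \<alpha>hat \<theta> \<in> Ctrl \<and> Gamma_dual M Ctrl Z \<theta> = Gamma_ctrl M Z \<theta> (\<alpha>hat \<theta>)"
    and dual_limit: "\<And>\<theta>. \<theta> \<in> theta_range \<theta>bar \<Longrightarrow>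
          ((\<lambda>T. log_mgf M Z \<theta> (\<alpha>hat \<theta>) T) \<longlongrightarrow> Gamma_dual M Ctrl Z \<theta>) at_top"
    and Gamma_C1: "C1_on_with (Gamma_dual M Ctrl Z) G' (theta_range \<theta>bar)"
begin

abbreviation "I \<equiv> theta_range \<theta>bar"

abbreviation "X \<equiv> X_of Z"

definition g :: "real \<Rightarrow> real" where "g \<theta> = real_of_ereal (Gamma_dual M Ctrl Z \<theta>)"

abbreviation prob_rate :: "real \<Rightarrow> ('w, 'q) control \<Rightarrow> ereal" where
  "prob_rate x \<alpha> \<equiv> Limsup at_top (\<lambda>T. log_prob M Z x \<alpha> T)"

definition g_conjugate :: "real \<Rightarrow> ereal" where
  "g_conjugate x = (SUP \<theta>\<in>I. ereal (\<theta> * x) - Gamma_dual M Ctrl Z \<theta>)"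

lemma X_measurable: "\<alpha> \<in> Ctrl \<Longrightarrow> 0 \<le> T \<Longrightarrow> X \<alpha> T \<in> borel_measurable M"
  using borel_measurable_continuous_onI[OF continuous_on_fst[OF continuous_on_id]]
    measurable_compose[OF state_measurable] unfolding X_of_def by blast

lemma Gamma_dual_eq: "\<theta> \<in> I \<Longrightarrow> Gamma_dual M Ctrl Z \<theta> = ereal (g \<theta>)"
  using Gamma_C1 by (auto simp: C1_on_with_def g_def ereal_real)

lemma g_derivative: "\<theta> \<in> I \<Longrightarrow> (g has_real_derivative G' \<theta>) (at \<theta> within I)"
  using Gamma_C1 by (simp add: C1_on_with_def g_def[abs_def])

lemma zero_in_I: "0 \<in> I"
  using \<theta>bar_pos by (simp add: theta_range_def zero_ereal_def[symmetric])

lemma I_down_closed: "\<theta> \<in> I \<Longrightarrow> 0 \<le> s \<Longrightarrow> s \<le> \<theta> \<Longrightarrow> s \<in> I"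
  by (auto simp: theta_range_def intro: le_less_trans[of "ereal s" "ereal \<theta>"])

lemma convex_I: "convex I"
proof (rule convexI)
  fix s t u v :: real
  assume st: "s \<in> I" "t \<in> I" and uv: "0 \<le> u" "0 \<le> v" "u + v = 1"
  have "max s t \<in> I" using st by (simp add: max_def)
  moreover have "u * s + v * t \<le> u * max s t + v * max s t"
    using uv by (intro add_mono mult_left_mono) auto
  then have "u * s + v * t \<le> max s t" using uv by (simp add: distrib_right[symmetric])
  moreover have "0 \<le> u * s + v * t" using st uv by (simp add: theta_range_def)
  ultimately show "u *\<^sub>R s + v *\<^sub>R t \<in> I" by (simp add: I_down_closed)
qed

lemma log_mgf_le_iff:
  "T > 0 \<Longrightarrow> log_mgf M Z \<theta> \<alpha> T \<le> ereal a \<longleftrightarrow>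
    (\<integral>\<^sup>+ \<omega>. ennreal (exp (\<theta> * X \<alpha> T \<omega>)) \<partial>M) \<le> ennreal (exp (a * T))"
  by (simp add: log_mgf_def scaled_eln_le_iff)

lemma le_log_mgf_iff:
  "T > 0 \<Longrightarrow> ereal a \<le> log_mgf M Z \<theta> \<alpha> T \<longleftrightarrow>
    ennreal (exp (a * T)) \<le> (\<integral>\<^sup>+ \<omega>. ennreal (exp (\<theta> * X \<alpha> T \<omega>)) \<partial>M)"
  by (simp add: log_mgf_def le_scaled_eln_iff)

lemma Xbar_event: "T > 0 \<Longrightarrow> {\<omega> \<in> space M. x \<le> Xbar Z \<alpha> T \<omega>} = {\<omega> \<in> space M. x * T \<le> X \<alpha> T \<omega>}"
  by (simp add: Xbar_def pos_le_divide_eq)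

lemma eventually_moment_le:
  assumes "\<alpha> \<in> Ctrl" "\<theta> \<in> I" "g \<theta> < a"
  shows "\<forall>\<^sub>F T in at_top. (\<integral>\<^sup>+ \<omega>. ennreal (exp (\<theta> * X \<alpha> T \<omega>)) \<partial>M) \<le> ennreal (exp (a * T))"
proof -
  have "Gamma_ctrl M Z \<theta> \<alpha> \<le> Gamma_dual M Ctrl Z \<theta>"
    unfolding Gamma_dual_def using assms(1) by (rule SUP_upper)
  also have "\<dots> < ereal a" using assms by (simp add: Gamma_dual_eq)
  finally have "\<forall>\<^sub>F T in at_top. log_mgf M Z \<theta> \<alpha> T < ereal a"
    unfolding Gamma_ctrl_def by (rule Limsup_lessD)
  then show ?thesis using eventually_gt_at_top[of 0]
    by eventually_elim (simp add: log_mgf_le_iff[symmetric] less_imp_le)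
qed

lemma eventually_moment_ge:
  assumes "\<theta> \<in> I" "a < g \<theta>"
  shows "\<forall>\<^sub>F T in at_top. ennreal (exp (a * T)) \<le> (\<integral>\<^sup>+ \<omega>. ennreal (exp (\<theta> * X (\<alpha>hat \<theta>) T \<omega>)) \<partial>M)"
proof -
  have "\<forall>\<^sub>F T in at_top. ereal a < log_mgf M Z \<theta> (\<alpha>hat \<theta>) T"
    using assms by (intro order_tendstoD(1)[OF dual_limit]) (auto simp: Gamma_dual_eq)
  then show ?thesis using eventually_gt_at_top[of 0]
    by eventually_elim (simp add: le_log_mgf_iff[symmetric] less_imp_le)
qed

text \<open>At an intermediate point take the control that is optimal there: its rate attains \<open>g\<close> as a limit,
  while at the two end points its rates are at most \<open>g\<close>. Convexity at each fixed \<open>T\<close> therefore passes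
  to \<open>g\<close>.\<close>

lemma convex_g: "convex_on I g"
proof (rule convex_onI[OF _ convex_I])
  fix u s t :: real
  assume u: "0 < u" "u < 1" and st: "s \<in> I" "t \<in> I"
  define m where "m = (1 - u) * s + u * t"
  have m: "m \<in> I" unfolding m_def using convexD_alt[OF convex_I st, of u] u by simp
  have "g m \<le> (1 - u) * g s + u * g t + e" if e: "e > 0" for e
  proof (rule ccontr)
    assume "\<not> ?thesis"
    moreover have "(1 - u) * (g s + e / 2) + u * (g t + e / 2) = (1 - u) * g s + u * g t + e / 2"
      by (simp add: field_simps)
    ultimately have less: "(1 - u) * (g s + e / 2) + u * (g t + e / 2) + e / 2 < g m" by linarith
    have "\<alpha>hat m \<in> Ctrl" using dual_solution[OF m] by simp
    have "g s < g s + e / 2" "g t < g t + e / 2" using e by auto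
    note ends = eventually_moment_le[OF \<open>\<alpha>hat m \<in> Ctrl\<close> st(1) this(1)]
      eventually_moment_le[OF \<open>\<alpha>hat m \<in> Ctrl\<close> st(2) this(2)]
    have "\<forall>\<^sub>F T::real in at_top. False"
      using ends eventually_moment_ge[OF m less] eventually_gt_at_top[of 0]
    proof eventually_elim
      case (elim T)
      have "ennreal (exp (((1 - u) * (g s + e / 2) + u * (g t + e / 2) + e / 2) * T))
          \<le> ennreal (exp ((1 - u) * ((g s + e / 2) * T) + u * ((g t + e / 2) * T)))"
        using exp_moment_convex[OF X_measurable _ _ elim(1,2), of u] elim(3) \<open>\<alpha>hat m \<in> Ctrl\<close> elim(4) u
        unfolding m_def by (meson less_imp_le order_trans)
      then have "e / 2 * T \<le> 0" by (simp add: algebra_simps)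
      then show False using e elim(4) by (simp add: mult_le_0_iff)
    qed
    then show False by simp
  qed
  then show "g ((1 - u) *\<^sub>R s + u *\<^sub>R t) \<le> (1 - u) * g s + u * g t"
    unfolding m_def by (simp add: field_le_epsilon)
qed

lemma g_zero: "g 0 = 0"
proof -
  have "log_mgf M Z 0 \<alpha> T = 0" for \<alpha> T
    by (simp add: log_mgf_def eln_def emeasure_space_1 zero_ereal_def)
  then have "Gamma_ctrl M Z 0 \<alpha> = 0" for \<alpha>
    by (simp add: Gamma_ctrl_def Limsup_const)
  then show ?thesis using dual_solution[OF zero_in_I] by (simp add: g_def)
qed

lemma G'_mono: "s \<in> I \<Longrightarrow> t \<in> I \<Longrightarrow> s \<le> t \<Longrightarrow> G' s \<le> G' t"
  using convex_derivative_mono[OF convex_g] g_derivative by blast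

lemma g_above_tangent_at_zero: "\<theta> \<in> I \<Longrightarrow> \<theta> * G' 0 \<le> g \<theta>"
  using convex_above_tangent_within[OF convex_g zero_in_I _ g_derivative[OF zero_in_I]]
  by (fastforce simp: g_zero mult.commute)

lemma left_end_limit_eq: "left_end_limit G' \<theta>bar = (SUP \<theta>\<in>I. ereal (G' \<theta>))"
  using left_end_limit_mono[OF \<theta>bar_pos] G'_mono by blast

lemma slope_attained:
  assumes y: "G' 0 < y" "ereal y < left_end_limit G' \<theta>bar"
  shows "\<exists>\<theta>. 0 < \<theta> \<and> ereal \<theta> < \<theta>bar \<and> G' \<theta> = y"
proof -
  obtain t where t: "t \<in> I" "y < G' t"
    using y(2) by (auto simp: left_end_limit_eq less_SUP_iff)
  have "{0..t} \<subseteq> I" using t(1) I_down_closed by auto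
  then have "continuous_on {0..t} G'"
    using Gamma_C1 continuous_on_subset unfolding C1_on_with_def by blast
  moreover have "0 \<le> t" using t(1) by (simp add: theta_range_def)
  ultimately obtain s where s: "0 \<le> s" "s \<le> t" "G' s = y"
    using IVT'[of G' 0 y t] y t by auto
  then have "s \<in> I" using t I_down_closed by blast
  moreover have "s \<noteq> 0" using s y by auto
  ultimately have "0 < s \<and> ereal s < \<theta>bar \<and> G' s = y" using s by (simp add: theta_range_def)
  then show ?thesis by blast
qed

section \<open>Upper and lower bounds for the decay rate\<close>

lemma prob_rate_le:
  assumes "\<alpha> \<in> Ctrl"
  shows "prob_rate x \<alpha> \<le> - g_conjugate x"
proof -
  have "prob_rate x \<alpha> \<le> ereal (g \<theta> - \<theta> * x)" if \<theta>: "\<theta> \<in> I" for \<theta>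
  proof (rule ereal_le_epsilon2)
    fix e :: real assume "e > 0"
    then have "g \<theta> < g \<theta> + e" by simp
    have "\<forall>\<^sub>F T in at_top. log_prob M Z x \<alpha> T \<le> ereal (g \<theta> + e - \<theta> * x)"
      using eventually_moment_le[OF assms \<theta> \<open>g \<theta> < g \<theta> + e\<close>] eventually_gt_at_top[of 0]
    proof eventually_elim
      case (elim T)
      have "0 \<le> \<theta>" using \<theta> by (simp add: theta_range_def)
      from Chernoff_bound[OF X_measurable[OF assms] this elim(1), of "x * T"] elim(2)
      show ?case by (simp add: log_prob_def Xbar_event scaled_eln_le_iff algebra_simps)
    qed
    then have "prob_rate x \<alpha> \<le> ereal (g \<theta> + e - \<theta> * x)" by (rule Limsup_bounded)
    then show "prob_rate x \<alpha> \<le> ereal (g \<theta> - \<theta> * x) + ereal e" by (simp add: algebra_simps)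
  qed
  then have "g_conjugate x \<le> - prob_rate x \<alpha>"
    unfolding g_conjugate_def
    by (intro SUP_least) (subst ereal_minus_le_minus[symmetric], auto simp: Gamma_dual_eq)
  then show ?thesis by (metis ereal_minus_le_minus ereal_uminus_uminus)
qed

text \<open>Put \<open>c = G' \<theta>\<close>. The moments of the optimal control at the neighbouring exponents \<open>\<theta> + s\<close> and
  \<open>\<theta> - s\<close> grow at rates bounded by \<open>g\<close>, hence by the tangent of \<open>g\<close> at \<open>\<theta>\<close> up to \<open>o(s)\<close>. This is less
  than the margin \<open>s * \<epsilon>\<close> that the window from \<open>c - \<epsilon>\<close> to \<open>c + \<epsilon>\<close> offers, so the
  window carries most of the \<open>\<theta>\<close>-moment. There the exponential weight is at most
  \<open>exp (\<theta> * (c + \<epsilon>) * T)\<close>, which leaves the claimed rate for the probability, up to an error that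
  is made small through \<open>\<epsilon>\<close>.\<close>

lemma prob_rate_ge:
  assumes \<theta>: "\<theta> \<in> I" "0 < \<theta>" and x: "x < G' \<theta>"
  shows "ereal (g \<theta> - \<theta> * G' \<theta>) \<le> prob_rate x (\<alpha>hat \<theta>)"
proof (rule ereal_le_epsilon2)
  fix e :: real assume e: "e > 0"
  define c where "c = G' \<theta>"
  define \<epsilon> where "\<epsilon> = min (c - x) (e / (2 * \<theta>))"
  have \<epsilon>: "\<epsilon> > 0" "x \<le> c - \<epsilon>" using x e \<theta> by (auto simp: \<epsilon>_def c_def)
  have "\<theta> * \<epsilon> \<le> \<theta> * (e / (2 * \<theta>))" using \<theta> by (intro mult_left_mono) (auto simp: \<epsilon>_def)
  then have \<theta>\<epsilon>: "\<theta> * \<epsilon> \<le> e / 2" using \<theta> by simp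
  have ctrl: "\<alpha>hat \<theta> \<in> Ctrl" using dual_solution[OF \<theta>(1)] by simp
  obtain d where d: "d > 0" "\<And>z. z \<in> I \<Longrightarrow> \<bar>z - \<theta>\<bar> < d \<Longrightarrow>
      \<bar>g z - g \<theta> - c * (z - \<theta>)\<bar> \<le> \<epsilon> / 2 * \<bar>z - \<theta>\<bar>"
    using g_derivative[OF \<theta>(1)] half_gt_zero[OF \<epsilon>(1)]
    unfolding has_field_derivative_def has_derivative_within_alt real_norm_def c_def by blast
  obtain t where t: "\<theta> < t" "t \<in> I"
  proof -
    have "ereal \<theta> < \<theta>bar" using \<theta> by (simp add: theta_range_def)
    then obtain q where "ereal \<theta> < ereal q" "ereal q < \<theta>bar" using ereal_dense2 by blast
    then show ?thesis using that \<theta> by (auto simp: theta_range_def)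
  qed
  define s where "s = min (d / 2) (min \<theta> (t - \<theta>))"
  have s: "s > 0" "s < d" using d(1) \<theta> t by (auto simp: s_def)
  have in_I: "\<theta> + s \<in> I" "\<theta> - s \<in> I"
    using I_down_closed[OF t(2), of "\<theta> + s"] I_down_closed[OF \<theta>(1), of "\<theta> - s"] \<theta> s
    by (auto simp: s_def)
  \<comment> \<open>The tails outside the window have rates at least \<open>s * \<epsilon> / 2 \<ge> 4 * \<delta>\<close> below \<open>g \<theta>\<close>, hence are
    eventually at most at \<open>g \<theta> - 2 * \<delta>\<close>, while the \<open>\<theta>\<close>-moment is eventually at \<open>g \<theta> - \<delta>\<close> or above.
    The other bound on \<open>\<delta>\<close> keeps the total loss within \<open>e\<close>.\<close>
  define \<delta> where "\<delta> = min (e / 4) (s * \<epsilon> / 8)"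
  have \<delta>: "\<delta> > 0" "2 * \<delta> \<le> e / 2" "\<delta> \<le> s * \<epsilon> / 8" using e s \<epsilon> by (auto simp: \<delta>_def)
  have "\<bar>g (\<theta> + s) - g \<theta> - c * s\<bar> \<le> \<epsilon> / 2 * s" "\<bar>g (\<theta> - s) - g \<theta> + c * s\<bar> \<le> \<epsilon> / 2 * s"
    using d(2)[OF in_I(1)] d(2)[OF in_I(2)] s by auto
  then have near: "g (\<theta> + s) < g \<theta> - 2 * \<delta> + s * (c + \<epsilon>)" "g (\<theta> - s) < g \<theta> - 2 * \<delta> - s * (c - \<epsilon>)"
    using \<delta>(3) mult_pos_pos[OF s(1) \<epsilon>(1)] unfolding abs_le_iff
    by (simp_all add: distrib_left right_diff_distrib mult.commute[of s]; linarith)+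
  have "\<forall>\<^sub>F T in at_top. 3 / \<delta> \<le> T" by (rule eventually_ge_at_top)
  then have "\<forall>\<^sub>F T in at_top. ereal (g \<theta> - \<theta> * c - e) \<le> log_prob M Z x (\<alpha>hat \<theta>) T"
    using eventually_moment_le[OF ctrl in_I(1) near(1)] eventually_moment_le[OF ctrl in_I(2) near(2)]
      eventually_moment_ge[OF \<theta>(1), of "g \<theta> - \<delta>", simplified, OF \<delta>(1)] eventually_gt_at_top[of 0]
  proof eventually_elim
    case (elim T)
    define b where "b = (g \<theta> - 2 * \<delta>) * T"
    have "3 \<le> \<delta> * T" using elim(1) \<delta>(1) by (simp add: field_simps)
    then have "3 \<le> exp (\<delta> * T)" using exp_ge_add_one_self[of "\<delta> * T"] by linarith
    then have "3 * exp b \<le> exp (\<delta> * T) * exp b" by (intro mult_right_mono) auto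
    also have "\<dots> = exp ((g \<theta> - \<delta>) * T)" by (simp add: b_def exp_add[symmetric] algebra_simps)
    finally have mid: "ennreal (3 * exp b) \<le> (\<integral>\<^sup>+ \<omega>. ennreal (exp (\<theta> * X (\<alpha>hat \<theta>) T \<omega>)) \<partial>M)"
      using elim(4) by (meson ennreal_leI order_trans)
    have "ennreal (exp ((g \<theta> - \<theta> * c - e) * T)) \<le> ennreal (exp (b - \<theta> * ((c + \<epsilon>) * T)))"
    proof (intro ennreal_leI, simp)
      have "(g \<theta> - \<theta> * c - e) * T \<le> (g \<theta> - 2 * \<delta> - \<theta> * c - \<theta> * \<epsilon>) * T"
        using \<theta>\<epsilon> \<delta>(2) elim(5) by (intro mult_right_mono) auto
      then show "(g \<theta> - \<theta> * c - e) * T \<le> b - \<theta> * ((c + \<epsilon>) * T)"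
        by (simp add: b_def algebra_simps)
    qed
    also have "\<dots> \<le> emeasure M {\<omega> \<in> space M. (c - \<epsilon>) * T \<le> X (\<alpha>hat \<theta>) T \<omega>}"
      using X_measurable[OF ctrl] elim(5) \<theta>(2) s(1) mid elim(2,3)
      by (intro window_probability_bound[where s = s and r = s]) (auto simp: b_def algebra_simps)
    also have "\<dots> \<le> emeasure M {\<omega> \<in> space M. x * T \<le> X (\<alpha>hat \<theta>) T \<omega>}"
    proof (rule emeasure_mono)
      have "x * T \<le> (c - \<epsilon>) * T" using \<epsilon>(2) elim(5) by (intro mult_right_mono) auto
      then show "{\<omega> \<in> space M. (c - \<epsilon>) * T \<le> X (\<alpha>hat \<theta>) T \<omega>} \<subseteq> {\<omega> \<in> space M. x * T \<le> X (\<alpha>hat \<theta>) T \<omega>}"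
        by auto
      have [measurable]: "X (\<alpha>hat \<theta>) T \<in> borel_measurable M" using X_measurable[OF ctrl] elim(5) by simp
      show "{\<omega> \<in> space M. x * T \<le> X (\<alpha>hat \<theta>) T \<omega>} \<in> sets M" by measurable
    qed
    finally show ?case
      using elim(5) by (simp add: log_prob_def Xbar_event le_scaled_eln_iff)
  qed
  then have "ereal (g \<theta> - \<theta> * c - e) \<le> prob_rate x (\<alpha>hat \<theta>)"
    by (rule le_Limsup[rotated]) simp
  then have "ereal (g \<theta> - \<theta> * c - e) + ereal e \<le> prob_rate x (\<alpha>hat \<theta>) + ereal e"
    by (rule add_right_mono)
  then show "ereal (g \<theta> - \<theta> * G' \<theta>) \<le> prob_rate x (\<alpha>hat \<theta>) + ereal e"
    by (simp add: c_def)
qed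

section \<open>Duality and nearly optimal controls\<close>

lemma g_conjugate_ge: "\<theta> \<in> I \<Longrightarrow> ereal (\<theta> * x - g \<theta>) \<le> g_conjugate x"
  unfolding g_conjugate_def by (rule SUP_upper2) (auto simp: Gamma_dual_eq)

lemma g_conjugate_nonneg: "0 \<le> g_conjugate x"
  using g_conjugate_ge[OF zero_in_I, of x] by (simp add: g_zero zero_ereal_def)

lemma ld_value_le: "ld_value M Ctrl Z x \<le> - g_conjugate x"
  unfolding ld_value_def by (intro SUP_least prob_rate_le)

lemma prob_rate_le_ld_value: "\<alpha> \<in> Ctrl \<Longrightarrow> prob_rate x \<alpha> \<le> ld_value M Ctrl Z x"
  unfolding ld_value_def by (rule SUP_upper)

text \<open>Both cases of the control aim at slopes slightly above \<open>y = max x (G' 0)\<close>. The lower bound at slope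
  \<open>y + 1 / n\<close> misses \<open>- g_conjugate x\<close> by at most \<open>\<theta> / n\<close>, where \<open>\<theta>\<close> is the exponent of that slope; these
  exponents stay bounded because \<open>G'\<close> is monotone, so the loss vanishes. At \<open>y = G' 0\<close> the
  term \<open>\<theta> * y - g \<theta>\<close> is never positive, as \<open>g\<close> lies above its tangent at the origin.\<close>

lemma near_opt_control_rate:
  assumes sel: "\<And>y. G' 0 < y \<Longrightarrow> ereal y < left_end_limit G' \<theta>bar \<Longrightarrow>
      0 < \<theta>sel y \<and> ereal (\<theta>sel y) < \<theta>bar \<and> G' (\<theta>sel y) = y"
    and strict: "ereal (G' 0) < left_end_limit G' \<theta>bar"
    and x: "ereal x < left_end_limit G' \<theta>bar"
  shows "(\<lambda>n. prob_rate x (near_opt_control \<alpha>hat \<theta>sel G' x n)) \<longlonglongrightarrow> - g_conjugate x"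
    and "ld_value M Ctrl Z x = - g_conjugate x"
proof -
  define y where "y = max x (G' 0)"
  define \<theta> where "\<theta> n = \<theta>sel (y + 1 / real n)" for n
  have control: "near_opt_control \<alpha>hat \<theta>sel G' x n = \<alpha>hat (\<theta> n)" for n
    by (auto simp: near_opt_control_def \<theta>_def y_def max_def)
  have "ereal y < left_end_limit G' \<theta>bar" using x strict by (simp add: y_def max_def)
  then obtain z where z: "ereal y < ereal z" "ereal z < left_end_limit G' \<theta>bar"
    using ereal_dense2 by blast
  then obtain N where N: "1 / real (Suc N) < z - y"
    using nat_approx_posE[of "z - y"] by auto
  have \<theta>: "0 < \<theta> n" "\<theta> n \<in> I" "G' (\<theta> n) = y + 1 / real n" if "Suc N \<le> n" for n
  proof -
    have "1 / real n \<le> 1 / real (Suc N)" using that by (intro divide_left_mono) auto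
    then have "y + 1 / real n \<le> z" using N by simp
    then have "ereal (y + 1 / real n) < left_end_limit G' \<theta>bar"
      using z(2) le_less_trans ereal_less_eq(3) by blast
    moreover have "G' 0 < y + 1 / real n"
      using that by (auto simp: y_def intro: le_less_trans[of _ "max x (G' 0)"])
    ultimately show "0 < \<theta> n" "\<theta> n \<in> I" "G' (\<theta> n) = y + 1 / real n"
      using sel by (auto simp: \<theta>_def theta_range_def less_imp_le)
  qed
  have lower: "ereal (- (\<theta> (Suc N) / real n)) + - g_conjugate x \<le> prob_rate x (\<alpha>hat (\<theta> n))"
    if n: "Suc N \<le> n" for n
  proof -
    have "\<theta> n \<le> \<theta> (Suc N)"
    proof (rule ccontr)
      assume not_le: "\<not> ?thesis"
      then have "G' (\<theta> (Suc N)) \<le> G' (\<theta> n)" using \<theta>(2)[OF n] \<theta>(2)[of "Suc N"] by (intro G'_mono) auto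
      then have "1 / real (Suc N) \<le> 1 / real n" using \<theta>(3)[OF n] \<theta>(3)[of "Suc N"] by simp
      then have "real n \<le> real (Suc N)" using n by (simp add: divide_simps split: if_splits)
      then have "n = Suc N" using n by linarith
      then show False using not_le by simp
    qed
    then have loss: "\<theta> n / real n \<le> \<theta> (Suc N) / real n" by (rule divide_right_mono) simp
    have "ereal (\<theta> n * y - g (\<theta> n)) \<le> g_conjugate x"
    proof (cases "G' 0 < x")
      case True
      then show ?thesis using g_conjugate_ge[OF \<theta>(2)[OF n]] by (simp add: y_def)
    next
      case False
      then have "ereal (\<theta> n * y - g (\<theta> n)) \<le> 0"
        using g_above_tangent_at_zero[OF \<theta>(2)[OF n]] by (simp add: y_def zero_ereal_def)
      then show ?thesis using g_conjugate_nonneg order_trans by blast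
    qed
    then have "- g_conjugate x \<le> ereal (g (\<theta> n) - \<theta> n * y)"
      by (subst ereal_uminus_le_reorder) simp
    then have "ereal (- (\<theta> (Suc N) / real n)) + - g_conjugate x
        \<le> ereal (- (\<theta> n / real n)) + ereal (g (\<theta> n) - \<theta> n * y)"
      using loss by (intro add_mono) auto
    also have "\<dots> = ereal (g (\<theta> n) - \<theta> n * G' (\<theta> n))"
      using \<theta>(3)[OF n] by (simp add: algebra_simps)
    also have "\<dots> \<le> prob_rate x (\<alpha>hat (\<theta> n))"
    proof (rule prob_rate_ge[OF \<theta>(2,1)[OF n]])
      have "0 < 1 / real n" "x \<le> y" using n by (auto simp: y_def)
      then show "x < G' (\<theta> n)" using \<theta>(3)[OF n] by linarith
    qed
    finally show ?thesis .
  qed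
  have upper: "prob_rate x (\<alpha>hat (\<theta> n)) \<le> ld_value M Ctrl Z x" if "Suc N \<le> n" for n
    using prob_rate_le_ld_value dual_solution \<theta>(2)[OF that] by blast
  have "(\<lambda>n. ereal (- (\<theta> (Suc N) / real n))) \<longlonglongrightarrow> ereal (- 0)"
    by (intro tendsto_intros lim_const_over_n)
  then have "(\<lambda>n. ereal (- (\<theta> (Suc N) / real n)) + - g_conjugate x) \<longlonglongrightarrow> ereal (- 0) + - g_conjugate x"
    by (intro tendsto_add_ereal_general tendsto_const) auto
  then have lim: "(\<lambda>n. ereal (- (\<theta> (Suc N) / real n)) + - g_conjugate x) \<longlonglongrightarrow> - g_conjugate x"
    by (simp add: zero_ereal_def[symmetric])
  show "(\<lambda>n. prob_rate x (near_opt_control \<alpha>hat \<theta>sel G' x n)) \<longlonglongrightarrow> - g_conjugate x"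
    unfolding control
  proof (rule tendsto_sandwich[OF _ _ lim tendsto_const])
    show "\<forall>\<^sub>F n in sequentially. ereal (- (\<theta> (Suc N) / real n)) + - g_conjugate x \<le> prob_rate x (\<alpha>hat (\<theta> n))"
      using lower unfolding eventually_sequentially by blast
    show "\<forall>\<^sub>F n in sequentially. prob_rate x (\<alpha>hat (\<theta> n)) \<le> - g_conjugate x"
      using upper ld_value_le order_trans unfolding eventually_sequentially by blast
  qed
  have "- g_conjugate x \<le> ld_value M Ctrl Z x"
    using lim lower upper order_trans by (intro LIMSEQ_le_const2) blast+
  then show "ld_value M Ctrl Z x = - g_conjugate x" using ld_value_le by (intro antisym)
qed

lemma ld_value_eq:
  assumes x: "ereal x < left_end_limit G' \<theta>bar"
  shows "ld_value M Ctrl Z x = - g_conjugate x"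
proof (cases "ereal (G' 0) < left_end_limit G' \<theta>bar")
  case True
  obtain \<theta>sel where "\<And>y. G' 0 < y \<Longrightarrow> ereal y < left_end_limit G' \<theta>bar \<Longrightarrow>
      0 < \<theta>sel y \<and> ereal (\<theta>sel y) < \<theta>bar \<and> G' (\<theta>sel y) = y"
    using slope_attained by metis
  then show ?thesis using near_opt_control_rate(2) True x by blast
next
  \<comment> \<open>Here \<open>G'\<close> is constant, no slope above \<open>G' 0\<close> is available, and any fixed positive exponent
    already gives the value zero.\<close>
  case False
  obtain q where "ereal 0 < ereal q" "ereal q < \<theta>bar"
    using ereal_dense2[of 0 \<theta>bar] \<theta>bar_pos by (auto simp: zero_ereal_def)
  then have q: "q \<in> I" "0 < q" by (auto simp: theta_range_def)
  have "ereal (G' q) \<le> left_end_limit G' \<theta>bar"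
    unfolding left_end_limit_eq using q(1) by (rule SUP_upper)
  then have "ereal (G' q) \<le> ereal (G' 0)" using False by (meson not_less order_trans)
  then have Gq: "G' q = G' 0" using G'_mono[OF zero_in_I q(1)] q(2) by simp
  have "x < G' q" using x False Gq by (metis ereal_less(1) less_ereal.simps(1) less_le_trans not_less)
  then have "ereal (g q - q * G' q) \<le> ld_value M Ctrl Z x"
    using prob_rate_ge[OF q] prob_rate_le_ld_value dual_solution[OF q(1)] order_trans by blast
  moreover have "0 \<le> ereal (g q - q * G' q)"
    using g_above_tangent_at_zero[OF q(1)] by (simp add: Gq)
  moreover have "- g_conjugate x \<le> 0" using g_conjugate_nonneg[of x] by simp
  ultimately have "- g_conjugate x \<le> ld_value M Ctrl Z x" by order
  then show ?thesis using ld_value_le by (intro antisym)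
qed

end

theorem theorem5p2:
  fixes M :: "'w measure"
    and F :: "real \<Rightarrow> 'w measure"
    and A :: "(real ^ 'q::finite) set"
    and Ctrl :: "('w, 'q) control set"
    and Z :: "('w, 'q) control \<Rightarrow> ('w, 'd::finite) controlled_process"
    and \<theta>bar :: ereal
    and \<alpha>hat :: "real \<Rightarrow> ('w, 'q) control"
    and G' :: "real \<Rightarrow> real"
  assumes setting: "large_deviations_control M F A Ctrl Z"
    and \<theta>bar_pos: "0 < \<theta>bar"
    and dual_solution: "\<And>\<theta>. \<theta> \<in> theta_range \<theta>bar \<Longrightarrow>
          \<alpha>hat \<theta> \<in> Ctrl \<and> Gamma_dual M Ctrl Z \<theta> = Gamma_ctrl M Z \<theta> (\<alpha>hat \<theta>)"
    and dual_limit: "\<And>\<theta>. \<theta> \<in> theta_range \<theta>bar \<Longrightarrow>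
          ((\<lambda>T. log_mgf M Z \<theta> (\<alpha>hat \<theta>) T) \<longlongrightarrow> Gamma_dual M Ctrl Z \<theta>) at_top"
    and Gamma_C1: "C1_on_with (Gamma_dual M Ctrl Z) G' (theta_range \<theta>bar)"
  shows
    "(\<forall>x. ereal x < left_end_limit G' \<theta>bar \<longrightarrow>
       ld_value M Ctrl Z x = - (SUP \<theta>\<in>theta_range \<theta>bar. ereal (\<theta> * x) - Gamma_dual M Ctrl Z \<theta>)) \<and>
     (\<forall>y. G' 0 < y \<and> ereal y < left_end_limit G' \<theta>bar \<longrightarrow>
       (\<exists>\<theta>. 0 < \<theta> \<and> ereal \<theta> < \<theta>bar \<and> G' \<theta> = y)) \<and>
     (\<forall>\<theta>sel.
       (\<forall>y. G' 0 < y \<and> ereal y < left_end_limit G' \<theta>bar \<longrightarrow>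
          0 < \<theta>sel y \<and> ereal (\<theta>sel y) < \<theta>bar \<and> G' (\<theta>sel y) = y) \<longrightarrow>
       ereal (G' 0) < left_end_limit G' \<theta>bar \<longrightarrow>
       (\<forall>x. ereal x < left_end_limit G' \<theta>bar \<longrightarrow>
          (\<lambda>n. Limsup at_top (\<lambda>T. log_prob M Z x (near_opt_control \<alpha>hat \<theta>sel G' x n) T))
            \<longlonglongrightarrow> ld_value M Ctrl Z x))"
proof -
  interpret large_deviations_control M F A Ctrl Z by (rule setting)
  interpret solvable_dual_problem M F A Ctrl Z \<theta>bar \<alpha>hat G'
    by unfold_locales (fact \<theta>bar_pos dual_solution dual_limit Gamma_C1)+
  show ?thesis
    using ld_value_eq slope_attained near_opt_control_rate unfolding g_conjugate_def by auto
qed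

end
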